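(* For any integer $k\ge 2$ and any $n\ge 2k$, $$b_t^k(P_n)=\begin{cases}2\left\lfloor\frac{k-1}{2}\right\rfloor+1 & \text{if } n\equiv 0 \pmod 4,\\ k & \text{if } n\equiv 1,3\pmod 4,\\ 2\left\lfloor\frac{k-1}{2}\right\rfloor+2 & \text{if } n\equiv 2\pmod 4,\end{cases}$$ and $b_t^k(C_n)=b_t^k(P_n)+1$.
   Context: All graphs are finite, simple, undirected. $P_n$ is the path on $n$ vertices and $C_n$ the cycle on $n$ vertices. A total dominating set (TD-set) of a graph $G$ without isolated vertices is a set $S\subseteq V(G)$ with every vertex of $G$ adjacent to some vertex of $S$; $\gamma_t(G)$ is the minimum size of a TD-set. The $k$-total bondage number $b_t^k(G)$ is the minimum number of edges that must be deleted from $G$ so that the resulting graph has total domination number at least $\gamma_t(G)+k$; only deletions that leave no isolated vertices are allowed.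
   Formalization: The formula for P_n is claimed except when n=2k+1, or n=2k with k odd, where no admissible deletion exists (e.g. k=2, n=5) and the number is undefined (taken as infinity); b_t^k(C_n)=b_t^k(P_n)+1 is claimed for all n≥2k, both sides infinite there. *)

theory Defs
  imports Main "HOL-Library.Extended_Nat"
begin

text \<open>A finite simple undirected graph is a pair of a vertex set and a set of
  two-element subsets of it.\<close>

type_synonym 'a graph = "'a set \<times> 'a set set"

abbreviation verts :: "'a graph \<Rightarrow> 'a set" where
  "verts \<equiv> fst"

abbreviation edges :: "'a graph \<Rightarrow> 'a set set" where
  "edges \<equiv> snd"

definition simple_graph :: "'a graph \<Rightarrow> bool" where
  "simple_graph G \<longleftrightarrow> finite (verts G) \<and> (\<forall>e\<in>edges G. e \<subseteq> verts G \<and> card e = 2)"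

definition no_isolated :: "'a graph \<Rightarrow> bool" where
  "no_isolated G \<longleftrightarrow> (\<forall>v\<in>verts G. \<exists>u\<in>verts G. {u, v} \<in> edges G)"

definition td_set :: "'a graph \<Rightarrow> 'a set \<Rightarrow> bool" where
  "td_set G S \<longleftrightarrow> S \<subseteq> verts G \<and> (\<forall>v\<in>verts G. \<exists>u\<in>S. {u, v} \<in> edges G)"

text \<open>Meaningful only for a finite graph without isolated vertices; otherwise there is
  no total dominating set.\<close>

definition total_domination_number :: "'a graph \<Rightarrow> nat" where
  "total_domination_number G = Min (card ` {S. td_set G S})"

definition delete_edges :: "'a graph \<Rightarrow> 'a set set \<Rightarrow> 'a graph" where
  "delete_edges G F = (verts G, edges G - F)"

definition k_bondage_sets :: "nat \<Rightarrow> 'a graph \<Rightarrow> 'a set set set" where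
  "k_bondage_sets k G = {F. F \<subseteq> edges G \<and> no_isolated (delete_edges G F) \<and>
     total_domination_number (delete_edges G F) \<ge> total_domination_number G + k}"

text \<open>The minimum need not exist; the value \<open>\<infinity>\<close> (the infimum of the empty set) means
  that the number is undefined.\<close>

definition k_total_bondage_number :: "nat \<Rightarrow> 'a graph \<Rightarrow> enat" where
  "k_total_bondage_number k G = (INF F \<in> k_bondage_sets k G. enat (card F))"

definition path_graph :: "nat \<Rightarrow> nat graph" where
  "path_graph n = ({..<n}, {{i, i + 1} | i. i + 1 < n})"

text \<open>This is a cycle for \<open>n \<ge> 3\<close> only.\<close>

definition cycle_graph :: "nat \<Rightarrow> nat graph" where
  "cycle_graph n = ({..<n}, {{i, (i + 1) mod n} | i. i < n})"

lemma simple_graph_path: "simple_graph (path_graph n)"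
  by (auto simp: simple_graph_def path_graph_def)

lemma simple_graph_cycle:
  assumes "n \<ge> 3"
  shows "simple_graph (cycle_graph n)"
proof -
  have "i \<noteq> Suc i mod n" if "i < n" for i
    using that assms by (cases "Suc i = n") auto
  then show ?thesis
    using assms by (auto simp: simple_graph_def cycle_graph_def card_2_iff)
qed

lemma simple_graph_delete_edges: "simple_graph G \<Longrightarrow> simple_graph (delete_edges G F)"
  by (auto simp: simple_graph_def delete_edges_def)

end

theory Submission
  imports Defs
begin

text \<open>The total domination number of the path on \<open>n\<close> vertices is \<open>(n + e) / 2\<close>, where \<open>e\<close> is
  \<open>0, 1, 2, 1\<close> for \<open>n\<close> congruent to \<open>0, 1, 2, 3\<close> modulo 4. Deleting edges splits a path into
  shorter paths, so the total domination number grows by half the growth of the sum of the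
  excesses \<open>e\<close>. With \<open>p\<close> parts this sum is at most \<open>2 * p\<close>, with equality only if all parts have
  length 2 modulo 4, and then \<open>n\<close> is congruent to \<open>2 * p\<close>. Cutting off copies of the path on two
  vertices attains this bound. The cycle has the same total domination number as the path, and
  deleting any one of its edges leaves a path.\<close>

section \<open>Generic bounds and the closed formula for paths\<close>

text \<open>For n >= 2 this is the total domination number of the path, often written floor(n/2) +
  ceil(n/4) - floor(n/4). It is also the number of \<open>v < n\<close> with residue 0 or 1 modulo
  4, which is how the lower bound meets it.\<close>

definition path_td_number :: "nat \<Rightarrow> nat" where
  "path_td_number n = 2 * (n div 4) + min 2 (n mod 4)"

lemma td_number_le:
  assumes "finite (verts G)" "td_set G S"
  shows "total_domination_number G \<le> card S"
proof -
  have "finite {S. td_set G S}"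
    by (rule finite_subset[of _ "Pow (verts G)"]) (use assms in \<open>auto simp: td_set_def\<close>)
  then show ?thesis
    unfolding total_domination_number_def using assms by (intro Min_le) auto
qed

text \<open>Without isolated vertices \<open>verts G\<close> is itself a total dominating set, so
  the minimum is over a nonempty set.\<close>

lemma td_number_ge:
  assumes "finite (verts G)" "no_isolated G" "\<And>S. td_set G S \<Longrightarrow> m \<le> card S"
  shows "m \<le> total_domination_number G"
proof -
  have "finite {S. td_set G S}"
    by (rule finite_subset[of _ "Pow (verts G)"]) (use assms in \<open>auto simp: td_set_def\<close>)
  moreover have "td_set G (verts G)"
    using assms by (auto simp: td_set_def no_isolated_def)
  ultimately show ?thesis
    unfolding total_domination_number_def using assms by (subst Min_ge_iff) auto
qed

text \<open>The vertices of \<open>A\<close> have pairwise disjoint neighbourhoods (an open packing)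
  and \<open>S\<close> meets each of them, so choosing a dominator is injective on
  \<open>A\<close>.\<close>

lemma td_set_card_ge_packing:
  assumes "td_set G S" "finite S" "A \<subseteq> verts G"
    and packing: "\<And>a b u. \<lbrakk>a \<in> A; b \<in> A; {u, a} \<in> edges G; {u, b} \<in> edges G\<rbrakk> \<Longrightarrow> a = b"
  shows "card A \<le> card S"
proof -
  obtain f where f: "f a \<in> S" "{f a, a} \<in> edges G" if "a \<in> A" for a
    using assms(1,3) unfolding td_set_def by (metis subsetD)
  have "inj_on f A"
    using f(2) by (intro inj_onI) (metis packing)
  then show ?thesis
    using f(1) assms(2) by (intro card_inj_on_le[of f]) auto
qed

lemma path_td_number_Suc:
  "path_td_number (Suc n) = path_td_number n + (if n mod 4 < 2 then 1 else 0)"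
  using mod_less_divisor[of 4 n] by (auto simp: path_td_number_def div_Suc mod_Suc)

lemma path_td_number_le: "2 * path_td_number n \<le> n + 2"
  unfolding path_td_number_def distrib_left using div_mult_mod_eq[of n 4] by linarith

lemma path_td_number_less: "n mod 4 \<noteq> 2 \<Longrightarrow> 2 * path_td_number n < n + 2"
  unfolding path_td_number_def distrib_left using div_mult_mod_eq[of n 4] by linarith

lemma mod_4_cases: "n mod 4 = 0 \<or> n mod 4 = 1 \<or> n mod 4 = 2 \<or> n mod 4 = 3" for n :: nat
  using mod_less_divisor[of 4 n] by linarith

lemma path_td_number_cases:
  "n mod 4 = 0 \<Longrightarrow> 2 * path_td_number n = n"
  "odd n \<Longrightarrow> 2 * path_td_number n = n + 1"
  "n mod 4 = 2 \<Longrightarrow> 2 * path_td_number n = n + 2"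
proof -
  have n: "n div 4 * 4 + n mod 4 = n"
    by simp
  show "n mod 4 = 0 \<Longrightarrow> 2 * path_td_number n = n"
    and "n mod 4 = 2 \<Longrightarrow> 2 * path_td_number n = n + 2"
    unfolding path_td_number_def distrib_left using n by linarith+
  assume "odd n"
  then have "odd (n mod 4)"
    by (simp add: dvd_mod_iff)
  then have "n mod 4 = 1 \<or> n mod 4 = 3"
    using mod_4_cases[of n] by auto
  then show "2 * path_td_number n = n + 1"
    unfolding path_td_number_def distrib_left using n by linarith
qed

text \<open>Distinct vertices of a path with a common neighbour differ by 2, so the residues 0 and 1
  modulo 4 form an open packing; this is its size.\<close>

lemma card_mod4_01: "card {v. v < n \<and> v mod 4 < 2} = path_td_number n"
proof (induction n)
  case (Suc n)
  have eq: "{v. v < Suc n \<and> v mod 4 < 2} =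
      (if n mod 4 < 2 then insert n {v. v < n \<and> v mod 4 < 2} else {v. v < n \<and> v mod 4 < 2})"
    by (auto simp: less_Suc_eq)
  from Suc show ?case
    by (subst eq) (auto simp: path_td_number_Suc)
qed (simp add: path_td_number_def)

text \<open>The residues 1 and 2 dominate every vertex of a path except possibly the last one. The
  extra summand is 1 exactly when the last vertex is left over.\<close>

lemma card_mod4_12:
  "card {v. v < n \<and> (v mod 4 = 1 \<or> v mod 4 = 2)} + (if n mod 4 = 1 \<or> n mod 4 = 2 then 1 else 0) =
    path_td_number n"
proof (induction n)
  case (Suc n)
  let ?P = "\<lambda>v::nat. v mod 4 = 1 \<or> v mod 4 = 2"
  have eq: "{v. v < Suc n \<and> ?P v} =
      (if ?P n then insert n {v. v < n \<and> ?P v} else {v. v < n \<and> ?P v})"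
    by (auto simp: less_Suc_eq)
  have "card {v. v < Suc n \<and> ?P v} = card {v. v < n \<and> ?P v} + (if ?P n then 1 else 0)"
    by (subst eq) auto
  moreover have "(if Suc n mod 4 = 1 \<or> Suc n mod 4 = 2 then 1 else 0) + (if ?P n then 1 else 0) =
      (if ?P n then 1 else 0) + (if n mod 4 < 2 then 1 else (0::nat))"
    by (simp add: mod_Suc)
  ultimately show ?case
    using Suc by (simp add: path_td_number_Suc)
qed (simp add: path_td_number_def)

section \<open>Small dominating sets of segments and of cut paths\<close>

text \<open>Vertex \<open>l - 2\<close> joins the residues 1 and 2 in order to dominate the last
  vertex. It is new exactly when the extra summand of \<open>card_mod4_12\<close> is 1, so the size
  stays within \<open>path_td_number l\<close>.\<close>

lemma segment_td_set:
  assumes "2 \<le> l"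
  obtains T where "T \<subseteq> {..<l}" "card T \<le> path_td_number l"
    "\<And>v. v < l \<Longrightarrow> (\<exists>w\<in>T. v = Suc w) \<or> Suc v \<in> T"
proof
  let ?B = "{v. v < l \<and> (v mod 4 = 1 \<or> v mod 4 = 2)}"
  let ?T = "insert (l - 2) ?B"
  show "?T \<subseteq> {..<l}"
    using assms by auto
  have "card ?T = (if l - 2 \<in> ?B then card ?B else Suc (card ?B))"
    by (simp add: card_insert_if)
  moreover have "l - 2 \<in> ?B \<longleftrightarrow> \<not> (l mod 4 = 1 \<or> l mod 4 = 2)"
  proof -
    have "(l - 2) mod 4 = 1 \<or> (l - 2) mod 4 = 2 \<longleftrightarrow> \<not> (l mod 4 = 1 \<or> l mod 4 = 2)"
      using assms by (auto simp: le_iff_add mod_Suc split: if_splits)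
    then show ?thesis
      using assms by auto
  qed
  ultimately show "card ?T \<le> path_td_number l"
    using card_mod4_12[of l] by (auto split: if_splits)
  show "(\<exists>w\<in>?T. v = Suc w) \<or> Suc v \<in> ?T" if "v < l" for v
  proof (cases "Suc v = l")
    case True
    then show ?thesis
      using assms by (intro disjI1 bexI[of _ "l - 2"]) auto
  next
    case False
    have "v mod 4 < 4"
      by simp
    \<comment> \<open>Residues 0 and 1 are served by the right neighbour, residues 2 and 3 by the
      left one.\<close>
    then consider "v mod 4 = 0 \<or> v mod 4 = 1" | "v mod 4 = 2 \<or> v mod 4 = 3"
      by linarith
    then show ?thesis
    proof cases
      case 1
      then have "Suc v mod 4 = 1 \<or> Suc v mod 4 = 2"
        by (auto simp: mod_Suc)
      then show ?thesis
        using False that by auto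
    next
      case 2
      then obtain w where w: "v = Suc w"
        by (cases v) auto
      then have "w mod 4 = 1 \<or> w mod 4 = 2"
        using 2 by (auto simp: mod_Suc split: if_splits)
      then show ?thesis
        using w that by auto
    qed
  qed
qed

text \<open>Here \<open>D\<close> encodes the deleted edges \<open>{i, i + 1}\<close> by their left ends. A segment of \<open>l\<close>
  vertices needs at most \<open>(l + 2) / 2\<close> dominators, with equality only for \<open>l mod 4 = 2\<close>;
  so equality over all \<open>p\<close> segments forces \<open>n\<close> to be congruent to \<open>2 * p\<close>.\<close>

lemma cut_path_td_set:
  assumes "0 < n"
    and "\<And>v. v < n \<Longrightarrow> (\<exists>w. v = Suc w \<and> w \<notin> D) \<or> (Suc v < n \<and> v \<notin> D)"
  shows "\<exists>S\<subseteq>{..<n}. (\<forall>v<n. (\<exists>w\<in>S. v = Suc w \<and> w \<notin> D) \<or> (Suc v \<in> S \<and> v \<notin> D)) \<and>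
    2 * card S \<le> n + 2 * (card {i\<in>D. Suc i < n} + 1) \<and>
    (n mod 4 \<noteq> 2 * (card {i\<in>D. Suc i < n} + 1) mod 4 \<longrightarrow>
      2 * card S < n + 2 * (card {i\<in>D. Suc i < n} + 1))"
  using assms
proof (induction n rule: less_induct)
  case (less n)
  \<comment> \<open>\<open>D\<close> stays fixed while \<open>n\<close> shrinks in the induction, so
    only the cuts inside the current prefix count.\<close>
  let ?C = "{i\<in>D. Suc i < n}"
  have fin: "finite ?C"
    by (rule finite_subset[of _ "{..<n}"]) auto
  note pt = path_td_number_le path_td_number_less
  show ?case
  proof (cases "?C = {}")
    case True
    have "2 \<le> n"
      using less.prems(2)[of 0] less.prems(1) by auto
    then obtain T where T: "T \<subseteq> {..<n}" "card T \<le> path_td_number n"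
      "\<And>v. v < n \<Longrightarrow> (\<exists>w\<in>T. v = Suc w) \<or> Suc v \<in> T"
      using segment_td_set by blast
    have "(\<exists>w\<in>T. v = Suc w \<and> w \<notin> D) \<or> (Suc v \<in> T \<and> v \<notin> D)" if "v < n" for v
      using T(3)[OF that] T(1) True that by blast
    moreover have "2 * card T \<le> n + 2" "n mod 4 \<noteq> 2 \<Longrightarrow> 2 * card T < n + 2"
      using pt[of n] T(2) by linarith+
    ultimately show ?thesis
      using T(1) unfolding True by auto
  next
    case False
    \<comment> \<open>The last segment is peeled off at the largest cut: it starts at
      \<open>c\<close> and contains no cut, and the prefix of length \<open>c\<close> goes to the
      induction hypothesis.\<close>
    define i where "i = Max ?C"
    define c where "c = Suc i"
    define l where "l = n - c"
    have i: "i \<in> D" "Suc i < n"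
      using Max_in[OF fin False] by (auto simp: i_def)
    have imax: "j \<le> i" if "j \<in> D" "Suc j < n" for j
      using Max_ge[OF fin, of j] that by (auto simp: i_def)
    have c: "c < n" "0 < c"
      using i by (auto simp: c_def)
    have C: "?C = insert i {j\<in>D. Suc j < c}"
      using i imax by (fastforce simp: c_def le_less)
    have "finite {j\<in>D. Suc j < c}"
      by (rule finite_subset[OF _ fin]) (use c in auto)
    moreover define p where "p = card {j\<in>D. Suc j < c}"
    ultimately have cardC: "card ?C = p + 1"
      unfolding C by (simp add: c_def)
    have "(\<exists>w. v = Suc w \<and> w \<notin> D) \<or> (Suc v < c \<and> v \<notin> D)" if "v < c" for v
    proof -
      \<comment> \<open>The edge leaving the prefix, with left end \<open>i = c - 1\<close>, is
        itself cut, so no vertex below \<open>c\<close> relied on a neighbour beyond the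
        prefix.\<close>
      have "Suc v < c" if "v \<notin> D"
        using that i(1) \<open>v < c\<close> by (auto simp: c_def less_Suc_eq)
      then show ?thesis
        using less.prems(2)[of v] that c by auto
    qed
    from less.IH[OF c this] obtain S where S: "S \<subseteq> {..<c}"
      "\<forall>v<c. (\<exists>w\<in>S. v = Suc w \<and> w \<notin> D) \<or> (Suc v \<in> S \<and> v \<notin> D)"
      "2 * card S \<le> c + 2 * (p + 1)" "c mod 4 \<noteq> 2 * (p + 1) mod 4 \<Longrightarrow> 2 * card S < c + 2 * (p + 1)"
      unfolding p_def by blast
    have "2 \<le> l"
      using less.prems(2)[of c] c i by (auto simp: c_def l_def)
    then obtain T where T: "T \<subseteq> {..<l}" "card T \<le> path_td_number l"
      "\<And>v. v < l \<Longrightarrow> (\<exists>w\<in>T. v = Suc w) \<or> Suc v \<in> T"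
      using segment_td_set by blast
    let ?U = "S \<union> (+) c ` T"
    have "card ?U \<le> card S + card ((+) c ` T)"
      by (rule card_Un_le)
    also have "card ((+) c ` T) \<le> path_td_number l"
      using T(2) by (simp add: card_image)
    finally have cardU: "card ?U \<le> card S + path_td_number l"
      by simp
    have nc: "n = c + l"
      using c by (simp add: l_def)
    have "2 * card ?U \<le> n + 2 * (card ?C + 1)"
      using cardU S(3) pt(1)[of l] nc unfolding cardC by simp
    moreover have "2 * card ?U < n + 2 * (card ?C + 1)"
      if "n mod 4 \<noteq> 2 * (card ?C + 1) mod 4"
    proof -
      \<comment> \<open>If \<open>c\<close> and \<open>l\<close> both had the residues that allow
        equality, their sum \<open>n\<close> would have the residue of
        \<open>2 * (card ?C + 1)\<close>.\<close>
      have "c mod 4 \<noteq> 2 * (p + 1) mod 4 \<or> l mod 4 \<noteq> 2"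
        using that mod_add_cong[of c 4 "2 * (p + 1)" l 2] nc unfolding cardC by auto
      then show ?thesis
        using cardU S(3,4) pt[of l] nc unfolding cardC by auto
    qed
    moreover have "(\<exists>w\<in>?U. v = Suc w \<and> w \<notin> D) \<or> (Suc v \<in> ?U \<and> v \<notin> D)" if "v < n" for v
    proof (cases "v < c")
      case True
      then show ?thesis
        using S(2) by blast
    next
      case False
      have notD: "j \<notin> D" if "c \<le> j" "Suc j < n" for j
        using imax[of j] that by (auto simp: c_def)
      have "v - c < l"
        using False that by (simp add: l_def)
      from T(3)[OF this] show ?thesis
      proof
        assume "\<exists>w\<in>T. v - c = Suc w"
        then obtain w where w: "w \<in> T" "v - c = Suc w"
          by blast
        then have "v = Suc (c + w)"
          by simp
        then show ?thesis
          using w notD[of "c + w"] that by auto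
      next
        assume "Suc (v - c) \<in> T"
        then have "c + Suc (v - c) \<in> (+) c ` T" "Suc (v - c) < l"
          using T(1) by auto
        then show ?thesis
          using notD[of v] False by (auto simp: l_def)
      qed
    qed
    moreover have "?U \<subseteq> {..<n}"
      using S(1) T(1) c by (auto simp: l_def)
    ultimately show ?thesis
      by blast
  qed
qed

section \<open>The total domination number of a path after deletions\<close>

lemma path_edge_iff: "{u, v} \<in> edges (path_graph n) \<longleftrightarrow> (v = Suc u \<or> u = Suc v) \<and> u < n \<and> v < n"
  by (auto simp: path_graph_def doubleton_eq_iff)

lemma verts_path [simp]: "verts (path_graph n) = {..<n}"
  by (simp add: path_graph_def)

lemma verts_cycle [simp]: "verts (cycle_graph n) = {..<n}"
  by (simp add: cycle_graph_def)

lemma verts_delete_edges [simp]: "verts (delete_edges G F) = verts G"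
  by (simp add: delete_edges_def)

lemma edges_delete_edges [simp]: "edges (delete_edges G F) = edges G - F"
  by (simp add: delete_edges_def)

lemma delete_edges_empty [simp]: "delete_edges G {} = G"
  by (simp add: delete_edges_def)

lemma no_isolated_path: "2 \<le> n \<Longrightarrow> no_isolated (path_graph n)"
proof (unfold no_isolated_def, rule ballI)
  fix v assume n: "2 \<le> n" and v: "v \<in> verts (path_graph n)"
  show "\<exists>u\<in>verts (path_graph n). {u, v} \<in> edges (path_graph n)"
  proof (cases v)
    case 0
    then show ?thesis
      using n by (intro bexI[of _ 1]) (auto simp: path_edge_iff)
  next
    case (Suc w)
    then show ?thesis
      using v by (intro bexI[of _ w]) (auto simp: path_edge_iff)
  qed
qed

lemma card_path_cuts:
  assumes "F \<subseteq> edges (path_graph n)"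
  shows "card {i \<in> {i. {i, Suc i} \<in> F}. Suc i < n} = card F"
proof -
  let ?A = "{i \<in> {i. {i, Suc i} \<in> F}. Suc i < n}"
  have "(\<lambda>i. {i, Suc i}) ` ?A = F"
    using assms by (auto simp: path_graph_def)
  moreover have "inj_on (\<lambda>i. {i, Suc i}) ?A"
    by (auto simp: inj_on_def doubleton_eq_iff)
  ultimately show ?thesis
    using card_image by fastforce
qed

text \<open>The bound for cut paths applies because deleting \<open>card F\<close> edges leaves
  \<open>card F + 1\<close> segments, and the absence of isolated vertices means that each vertex
  keeps an uncut edge.\<close>

lemma path_delete_td_number_upper:
  assumes "0 < n" "F \<subseteq> edges (path_graph n)" "no_isolated (delete_edges (path_graph n) F)"
  defines "t \<equiv> total_domination_number (delete_edges (path_graph n) F)"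
  shows "2 * t \<le> n + 2 * (card F + 1)"
    and "n mod 4 \<noteq> 2 * (card F + 1) mod 4 \<Longrightarrow> 2 * t < n + 2 * (card F + 1)"
proof -
  let ?D = "{i. {i, Suc i} \<in> F}"
  have "(\<exists>w. v = Suc w \<and> w \<notin> ?D) \<or> (Suc v < n \<and> v \<notin> ?D)" if "v < n" for v
    using assms(3) that by (auto simp: no_isolated_def path_edge_iff insert_commute)
  from cut_path_td_set[OF assms(1) this, unfolded card_path_cuts[OF assms(2)]]
  obtain S where S: "S \<subseteq> {..<n}"
    "\<And>v. v < n \<Longrightarrow> (\<exists>w\<in>S. v = Suc w \<and> w \<notin> ?D) \<or> (Suc v \<in> S \<and> v \<notin> ?D)"
    "2 * card S \<le> n + 2 * (card F + 1)"
    "n mod 4 \<noteq> 2 * (card F + 1) mod 4 \<Longrightarrow> 2 * card S < n + 2 * (card F + 1)"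
    by blast
  have "td_set (delete_edges (path_graph n) F) S"
    unfolding td_set_def
  proof (intro conjI ballI)
    fix v assume "v \<in> verts (delete_edges (path_graph n) F)"
    then have v: "v < n"
      by simp
    from S(2)[OF v] show "\<exists>u\<in>S. {u, v} \<in> edges (delete_edges (path_graph n) F)"
    proof
      assume "\<exists>w\<in>S. v = Suc w \<and> w \<notin> ?D"
      then show ?thesis
        using v by (auto simp: path_edge_iff)
    next
      assume "Suc v \<in> S \<and> v \<notin> ?D"
      then show ?thesis
        using S(1) by (intro bexI[of _ "Suc v"]) (auto simp: path_edge_iff insert_commute)
    qed
  qed (use S(1) in simp)
  then have "t \<le> card S"
    unfolding t_def by (intro td_number_le) simp_all
  then show "2 * t \<le> n + 2 * (card F + 1)"
    and "n mod 4 \<noteq> 2 * (card F + 1) mod 4 \<Longrightarrow> 2 * t < n + 2 * (card F + 1)"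
    using S(3,4) by linarith+
qed

text \<open>Cutting off \<open>m\<close> copies of the path on two vertices. The packing consists of all vertices
  of these copies and of the vertices \<open>0, 1\<close> modulo 4 of the remaining path.\<close>

lemma path_cut_pairs:
  assumes "2 * m + 2 \<le> n"
  obtains F where "F \<subseteq> edges (path_graph n)" "card F = m"
    "no_isolated (delete_edges (path_graph n) F)"
    "2 * m + path_td_number (n - 2 * m) \<le> total_domination_number (delete_edges (path_graph n) F)"
proof
  \<comment> \<open>These edges separate the pairs {0, 1}, {2, 3} and so on; the remaining path
    starts at vertex \<open>2 * m\<close>.\<close>
  define F :: "nat set set" where "F = (\<lambda>i. {2 * i + 1, 2 * i + 2}) ` {..<m}"
  let ?G = "delete_edges (path_graph n) F"
  show "F \<subseteq> edges (path_graph n)"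
    using assms by (auto simp: F_def path_edge_iff)
  have "inj_on (\<lambda>i. {2 * i + 1, 2 * i + 2}) {..<m}"
    by (auto simp: inj_on_def doubleton_eq_iff)
  then show "card F = m"
    by (simp add: F_def card_image)
  have inF: "{v, Suc v} \<in> F \<longleftrightarrow> odd v \<and> v < 2 * m" for v
  proof
    assume "{v, Suc v} \<in> F"
    then obtain i where i: "i < m" "{v, Suc v} = {2 * i + 1, 2 * i + 2}"
      unfolding F_def by blast
    then have "v = 2 * i + 1"
      by (auto simp: doubleton_eq_iff)
    then show "odd v \<and> v < 2 * m"
      using i(1) by simp
  next
    assume v: "odd v \<and> v < 2 * m"
    define i where "i = v div 2"
    have i: "v = 2 * i + 1"
      using v by (simp add: i_def)
    then have "i < m"
      using v by simp
    then show "{v, Suc v} \<in> F"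
      unfolding F_def i by (intro image_eqI[of _ _ i]) simp_all
  qed
  have edge: "{u, v} \<in> edges ?G \<longleftrightarrow> u < n \<and> v < n \<and>
      ((v = Suc u \<and> \<not> (odd u \<and> u < 2 * m)) \<or> (u = Suc v \<and> \<not> (odd v \<and> v < 2 * m)))" for u v
    using inF[of u] inF[of v] by (auto simp: path_edge_iff insert_commute)
  show iso: "no_isolated ?G"
    unfolding no_isolated_def
  proof
    fix v assume "v \<in> verts ?G"
    then have v: "v < n"
      by simp
    show "\<exists>u\<in>verts ?G. {u, v} \<in> edges ?G"
    \<comment> \<open>Left ends of pairs and the first vertex \<open>2 * m\<close> of the remaining
      path keep their right neighbour, all other vertices their left one.\<close>
    proof (cases "v \<le> 2 * m \<and> even v")
      case True
      then have "Suc v < n"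
        using assms by auto
      then show ?thesis
        using True v by (intro bexI[of _ "Suc v"]) (simp_all only: edge, auto)
    next
      case False
      then obtain w where w: "v = Suc w"
        by (cases v) auto
      then show ?thesis
        using False v by (intro bexI[of _ w]) (simp_all only: edge, auto)
    qed
  qed
  define A where "A = {..<2 * m} \<union> (+) (2 * m) ` {v. v < n - 2 * m \<and> v mod 4 < 2}"
  have "card A = 2 * m + path_td_number (n - 2 * m)"
    unfolding A_def by (subst card_Un_disjoint) (auto simp: card_image card_mod4_01)
  moreover have "card A \<le> card S" if "td_set ?G S" for S
  proof (rule td_set_card_ge_packing[OF that])
    show "finite S"
      using that by (auto simp: td_set_def intro: finite_subset)
    show "A \<subseteq> verts ?G"
      using assms by (auto simp: A_def)
    fix a b u assume ab: "a \<in> A" "b \<in> A" and e: "{u, a} \<in> edges ?G" "{u, b} \<in> edges ?G"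
    \<comment> \<open>Distinct members of \<open>A\<close> with a common neighbour would be
      \<open>x\<close> and \<open>x + 2\<close>. For \<open>x < 2 * m\<close> one of the two edges
      between them is deleted; otherwise their residues, counted from \<open>2 * m\<close>, differ
      by 2 modulo 4 and cannot both be below 2.\<close>
    have False if "x \<in> A" "Suc (Suc x) \<in> A" "{Suc x, x} \<in> edges ?G" "{Suc x, Suc (Suc x)} \<in> edges ?G" for x
    proof (cases "x < 2 * m")
      case True
      then have "even x" "even (Suc x) \<or> 2 * m \<le> Suc x"
        using that(3,4) unfolding edge by auto
      moreover have "Suc x = 2 * m" if "2 * m \<le> Suc x"
        using True that by simp
      ultimately show False
        by (metis even_Suc dvd_triv_left)
    next
      case False
      then have "(x - 2 * m) mod 4 < 2" "Suc (Suc (x - 2 * m)) mod 4 < 2"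
        using that(1,2) by (auto simp: A_def Suc_diff_le)
      then show False
        by (simp add: mod_Suc split: if_splits)
    qed
    moreover have "u = Suc a \<or> a = Suc u" "u = Suc b \<or> b = Suc u"
      using e unfolding edge by auto
    ultimately show "a = b"
      using ab e by blast
  qed
  ultimately show "2 * m + path_td_number (n - 2 * m) \<le> total_domination_number ?G"
    using iso by (intro td_number_ge) auto
qed

text \<open>The lower bound is the case of no cut in \<open>path_cut_pairs\<close>, where the
  packing lives on the whole path; the upper bound is the set of
  \<open>segment_td_set\<close>.\<close>

lemma path_graph_td_number:
  assumes "2 \<le> n"
  shows "total_domination_number (path_graph n) = path_td_number n"
proof (rule antisym)
  obtain F where F: "F \<subseteq> edges (path_graph n)" "card F = 0"
    "2 * 0 + path_td_number (n - 2 * 0) \<le> total_domination_number (delete_edges (path_graph n) F)"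
    using path_cut_pairs[of 0 n] assms by auto
  have "finite (edges (path_graph n))"
    by (rule finite_subset[of _ "Pow {..<n}"]) (auto simp: path_graph_def)
  then have "F = {}"
    using F(1,2) finite_subset by fastforce
  then show "path_td_number n \<le> total_domination_number (path_graph n)"
    using F(3) by simp
next
  obtain T where T: "T \<subseteq> {..<n}" "card T \<le> path_td_number n"
      "\<And>v. v < n \<Longrightarrow> (\<exists>w\<in>T. v = Suc w) \<or> Suc v \<in> T"
    using segment_td_set[OF assms] by blast
  have "\<exists>u\<in>T. (v = Suc u \<or> u = Suc v) \<and> u < n \<and> v < n" if "v < n" for v
    using T(3)[OF that] T(1) that by blast
  then have "td_set (path_graph n) T"
    using T(1) by (simp add: td_set_def path_edge_iff)
  then show "total_domination_number (path_graph n) \<le> path_td_number n"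
    using T(2) td_number_le[of "path_graph n" T] by simp
qed

section \<open>The total domination number of the cycle\<close>

lemma cycle_edge_iff:
  "{u, v} \<in> edges (cycle_graph n) \<longleftrightarrow> u < n \<and> v < n \<and> (v = Suc u mod n \<or> u = Suc v mod n)"
  by (auto simp: cycle_graph_def doubleton_eq_iff)

lemma edges_cycle_graph:
  assumes "3 \<le> n"
  shows "edges (cycle_graph n) = insert {n - 1, 0} (edges (path_graph n))"
    and "{n - 1, 0} \<notin> edges (path_graph n)"
proof -
  have "{i, Suc i mod n} \<in> insert {n - 1, 0} (edges (path_graph n))" if "i < n" for i
    using that assms by (cases "Suc i = n") (auto simp: path_edge_iff)
  moreover have "{n - 1, 0} \<in> edges (cycle_graph n)"
    using assms by (auto simp: cycle_edge_iff)
  moreover have "{i, i + 1} \<in> edges (cycle_graph n)" if "i + 1 < n" for i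
    using that by (auto simp: cycle_edge_iff)
  ultimately show "edges (cycle_graph n) = insert {n - 1, 0} (edges (path_graph n))"
    by (auto simp: cycle_graph_def path_graph_def)
  show "{n - 1, 0} \<notin> edges (path_graph n)"
    using assms by (auto simp: path_edge_iff)
qed

lemma finite_edges_cycle: "finite (edges (cycle_graph n))"
  by (rule finite_subset[of _ "Pow {..<n}"]) (auto simp: cycle_graph_def)

lemma td_set_mono_edges:
  assumes "td_set G S" "verts G = verts H" "edges G \<subseteq> edges H"
  shows "td_set H S"
  using assms by (fastforce simp: td_set_def)

lemma no_isolated_cycle:
  assumes "3 \<le> n"
  shows "no_isolated (cycle_graph n)"
  using no_isolated_path[of n] assms by (auto simp: no_isolated_def edges_cycle_graph(1))

text \<open>In the cycle, \<open>S\<close> dominates \<open>w + 1\<close> iff \<open>w\<close> or \<open>w + 2\<close> lies in \<open>S\<close>. Applied to a set \<open>W\<close> of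
  residues closed under adding 2, this bounds the part of \<open>S\<close> inside \<open>W\<close>.\<close>

lemma cycle_td_set_card_ge:
  assumes "td_set (cycle_graph n) S" "2 \<le> n" "W \<subseteq> {..<n}"
    and closed: "\<And>w. w \<in> W \<Longrightarrow> (w + 2) mod n \<in> W"
  shows "card W \<le> 2 * card (S \<inter> W)"
proof -
  have fin: "finite (S \<inter> W)"
    using assms(3) by (meson finite_Int finite_lessThan finite_subset)
  \<comment> \<open>Adding \<open>n - 2\<close> modulo \<open>n\<close> is the shift by -2. The
    dominator \<open>u\<close> of \<open>w + 1\<close> is \<open>w\<close> or \<open>w + 2\<close>,
    and closure puts it in \<open>W\<close> in either case.\<close>
  have "W \<subseteq> (S \<inter> W) \<union> (\<lambda>u. (u + (n - 2)) mod n) ` (S \<inter> W)"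
  proof
    fix w assume w: "w \<in> W"
    then have wn: "w < n"
      using assms(3) by auto
    have "Suc w mod n \<in> verts (cycle_graph n)"
      using assms(2) by simp
    then obtain u where u: "u \<in> S" "{u, Suc w mod n} \<in> edges (cycle_graph n)"
      using assms(1) unfolding td_set_def by blast
    then have "u < n" "Suc w mod n = Suc u mod n \<or> u = Suc (Suc w) mod n"
      by (auto simp: cycle_edge_iff mod_Suc_eq)
    moreover have "w = u" if "Suc w mod n = Suc u mod n"
      using that wn \<open>u < n\<close> by (auto simp: mod_Suc split: if_splits)
    moreover have "w = ((w + 2) mod n + (n - 2)) mod n"
    proof -
      have "((w + 2) mod n + (n - 2)) mod n = (w + 2 + (n - 2)) mod n"
        by (rule mod_add_left_eq)
      also have "w + 2 + (n - 2) = w + n"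
        using assms(2) by simp
      finally show ?thesis
        using wn by simp
    qed
    ultimately show "w \<in> (S \<inter> W) \<union> (\<lambda>u. (u + (n - 2)) mod n) ` (S \<inter> W)"
      using u(1) w closed[OF w] by auto
  qed
  then have "card W \<le> card ((S \<inter> W) \<union> (\<lambda>u. (u + (n - 2)) mod n) ` (S \<inter> W))"
    using fin by (intro card_mono) auto
  also have "\<dots> \<le> card (S \<inter> W) + card ((\<lambda>u. (u + (n - 2)) mod n) ` (S \<inter> W))"
    by (rule card_Un_le)
  also have "card ((\<lambda>u. (u + (n - 2)) mod n) ` (S \<inter> W)) \<le> card (S \<inter> W)"
    using fin by (rule card_image_le)
  finally show ?thesis
    by simp
qed

text \<open>Taking all vertices for \<open>W\<close> gives \<open>n \<le> 2 * card S\<close>, which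
  suffices unless \<open>n mod 4 = 2\<close>. In that case n = 4q + 2, and the even and the odd
  vertices are two closed classes of odd size 2q + 1, so rounding up gives q + 1 elements of
  \<open>S\<close> in each, one more in total than n/2.\<close>

lemma cycle_td_set_ge:
  assumes "td_set (cycle_graph n) S" "2 \<le> n"
  shows "path_td_number n \<le> card S"
proof -
  have S: "S \<subseteq> {..<n}" "finite S"
    using assms(1) by (auto simp: td_set_def intro: finite_subset)
  show ?thesis
  proof (cases "n mod 4 = 2")
    case False
    have "card {..<n} \<le> 2 * card (S \<inter> {..<n})"
      using assms by (intro cycle_td_set_card_ge) auto
    then have "n \<le> 2 * card S"
      using S by (simp add: Int_absorb2)
    then show ?thesis
      using path_td_number_less[OF False] by simp
  next
    case True
    define q where "q = n div 4"
    have n: "n = 4 * q + 2"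
      using True by (metis q_def mult_div_mod_eq)
    let ?W = "\<lambda>r. (\<lambda>i. 2 * i + r) ` {..<2 * q + 1}"
    have closed: "(w + 2) mod n \<in> ?W r" if "w \<in> ?W r" "r < 2" for w r
    proof -
      from that(1) obtain i where i: "w = 2 * i + r" "i \<in> {..<2 * q + 1}"
        by (rule imageE)
      show ?thesis
      proof (cases "i = 2 * q")
        case True
        then have "w + 2 = r + n"
          by (simp add: n i(1))
        moreover have "r < n"
          using that(2) by (simp add: n)
        ultimately have "(w + 2) mod n = r"
          by (metis mod_add_self2 mod_less)
        then show ?thesis
          by (intro image_eqI[of _ _ 0]) auto
      next
        case False
        then have "(w + 2) mod n = 2 * Suc i + r"
          using i that(2) by (simp add: n)
        then show ?thesis
          using i False by (intro image_eqI[of _ _ "Suc i"]) auto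
      qed
    qed
    have half: "q + 1 \<le> card (S \<inter> ?W r)" if "r < 2" for r
    proof -
      have "card (?W r) \<le> 2 * card (S \<inter> ?W r)"
        using assms closed that by (intro cycle_td_set_card_ge) (auto simp: n)
      moreover have "card (?W r) = 2 * q + 1"
        by (subst card_image) (auto simp: inj_on_def)
      ultimately show ?thesis
        by linarith
    qed
    have "(S \<inter> ?W 0) \<inter> (S \<inter> ?W 1) = {}"
      by auto presburger
    then have "card (S \<inter> ?W 0) + card (S \<inter> ?W 1) = card ((S \<inter> ?W 0) \<union> (S \<inter> ?W 1))"
      using S(2) by (intro card_Un_disjoint[symmetric]) auto
    also have "\<dots> \<le> card S"
      using S(2) by (intro card_mono) auto
    finally show ?thesis
      using half[of 0] half[of 1] path_td_number_cases(3)[OF True] n by simp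
  qed
qed

lemma cycle_graph_td_number:
  assumes "3 \<le> n"
  shows "total_domination_number (cycle_graph n) = path_td_number n"
proof (rule antisym)
  show "path_td_number n \<le> total_domination_number (cycle_graph n)"
    using assms by (intro td_number_ge no_isolated_cycle cycle_td_set_ge) auto
  \<comment> \<open>The path spans the cycle, so its total dominating sets also dominate the
    cycle.\<close>
  have "total_domination_number (cycle_graph n) \<le> total_domination_number (path_graph n)"
    using assms
    by (intro td_number_ge no_isolated_path td_number_le)
      (auto simp: edges_cycle_graph(1) intro: td_set_mono_edges)
  then show "total_domination_number (cycle_graph n) \<le> path_td_number n"
    using assms by (simp add: path_graph_td_number)
qed

section \<open>Rotating the cycle and opening it to a path\<close>

text \<open>Introduced to show that bondage sets survive a rotation, so that a deleted edge of the
  cycle may be assumed to be \<open>{n - 1, 0}\<close>.\<close>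

definition map_graph :: "('a \<Rightarrow> 'b) \<Rightarrow> 'a graph \<Rightarrow> 'b graph" where
  "map_graph f G = (f ` verts G, (`) f ` edges G)"

lemma map_graph_edge_iff:
  assumes "inj_on f (verts G)" "simple_graph G" "u \<in> verts G" "v \<in> verts G"
  shows "{f u, f v} \<in> edges (map_graph f G) \<longleftrightarrow> {u, v} \<in> edges G"
proof
  assume "{f u, f v} \<in> edges (map_graph f G)"
  then obtain e where e: "e \<in> edges G" "f ` {u, v} = f ` e"
    by (auto simp: map_graph_def)
  then have "{u, v} = e"
    using assms by (subst inj_on_image_eq_iff[symmetric, OF assms(1)]) (auto simp: simple_graph_def)
  then show "{u, v} \<in> edges G"
    using e by simp
qed (auto simp: map_graph_def intro!: image_eqI[of _ _ "{u, v}"])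

lemma no_isolated_map_graph:
  assumes "inj_on f (verts G)" "simple_graph G"
  shows "no_isolated (map_graph f G) \<longleftrightarrow> no_isolated G"
proof -
  have "verts (map_graph f G) = f ` verts G"
    by (simp add: map_graph_def)
  then show ?thesis
    using map_graph_edge_iff[OF assms] by (auto simp: no_isolated_def)
qed

lemma td_set_map_graph:
  assumes "inj_on f (verts G)" "simple_graph G" "S \<subseteq> verts G"
  shows "td_set (map_graph f G) (f ` S) \<longleftrightarrow> td_set G S"
proof -
  have "verts (map_graph f G) = f ` verts G"
    by (simp add: map_graph_def)
  moreover have "{f u, f v} \<in> edges (map_graph f G) \<longleftrightarrow> {u, v} \<in> edges G"
    if "u \<in> S" "v \<in> verts G" for u v
    using map_graph_edge_iff[OF assms(1,2)] assms(3) that by blast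
  ultimately show ?thesis
    using assms(3) by (auto simp: td_set_def)
qed

lemma td_number_map_graph:
  assumes "inj_on f (verts G)" "simple_graph G"
  shows "total_domination_number (map_graph f G) = total_domination_number G"
proof -
  have "card ` {S. td_set (map_graph f G) S} = card ` {S. td_set G S}"
  proof (intro equalityI subsetI)
    fix m assume "m \<in> card ` {S. td_set (map_graph f G) S}"
    then obtain T where T: "m = card T" "td_set (map_graph f G) T"
      by auto
    then have "T \<subseteq> f ` verts G"
      by (simp add: td_set_def map_graph_def)
    then obtain S where S: "S \<subseteq> verts G" "T = f ` S"
      by (auto simp: subset_image_iff)
    then have "card T = card S"
      using assms(1) by (auto intro: card_image inj_on_subset)
    then show "m \<in> card ` {S. td_set G S}"
      using S T td_set_map_graph[OF assms] by auto
  next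
    fix m assume "m \<in> card ` {S. td_set G S}"
    then obtain S where S: "m = card S" "td_set G S"
      by auto
    then have sub: "S \<subseteq> verts G"
      by (simp add: td_set_def)
    then have "card (f ` S) = card S"
      using assms(1) by (auto intro: card_image inj_on_subset)
    then show "m \<in> card ` {S. td_set (map_graph f G) S}"
      using S td_set_map_graph[OF assms sub] by (metis image_eqI mem_Collect_eq)
  qed
  then show ?thesis
    by (simp add: total_domination_number_def)
qed

text \<open>Both deletions leave the same graph, and cycle and path have the same total domination
  number, so the threshold to be reached is the same.\<close>

lemma k_bondage_sets_cycle_iff:
  assumes "3 \<le> n" "{n - 1, 0} \<in> F"
  shows "F \<in> k_bondage_sets k (cycle_graph n) \<longleftrightarrow> F - {{n - 1, 0}} \<in> k_bondage_sets k (path_graph n)"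
proof -
  have "delete_edges (cycle_graph n) F = delete_edges (path_graph n) (F - {{n - 1, 0}})"
    using assms edges_cycle_graph[OF assms(1)] by (auto simp: prod_eq_iff)
  moreover have "F \<subseteq> edges (cycle_graph n) \<longleftrightarrow> F - {{n - 1, 0}} \<subseteq> edges (path_graph n)"
    using edges_cycle_graph[OF assms(1)] by auto
  ultimately show ?thesis
    using assms(1) by (simp add: k_bondage_sets_def path_graph_td_number cycle_graph_td_number)
qed

lemma map_graph_rotate_cycle:
  fixes n a :: nat
  assumes "0 < n"
  defines "r \<equiv> \<lambda>i. (i + a) mod n"
  shows "inj_on r {..<n}" "map_graph r (cycle_graph n) = cycle_graph n"
proof -
  show inj: "inj_on r {..<n}"
  proof (rule inj_onI)
    have le: "y \<le> x" if "x \<le> y" "y < n" "r x = r y" for x y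
    proof -
      have "n dvd (y + a) - (x + a)"
        using that by (subst mod_eq_dvd_iff_nat[symmetric]) (auto simp: r_def)
      then show ?thesis
        using that by (auto dest!: dvd_imp_le)
    qed
    fix x y assume xy: "x \<in> {..<n}" "y \<in> {..<n}" "r x = r y"
    have "x \<le> y \<Longrightarrow> y \<le> x" "y \<le> x \<Longrightarrow> x \<le> y"
      by (rule le; use xy in simp)+
    then show "x = y"
      by linarith
  qed
  have img: "r ` {..<n} = {..<n}"
    using assms(1) inj by (intro endo_inj_surj) (auto simp: r_def)
  have E: "edges (cycle_graph n) = (\<lambda>i. {i, Suc i mod n}) ` {..<n}"
    by (auto simp: cycle_graph_def)
  \<comment> \<open>The rotation commutes with the cyclic successor, hence permutes the
    edges.\<close>
  have "r (Suc i mod n) = Suc (r i) mod n" for i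
    by (simp add: r_def mod_simps)
  then have "(`) r ` edges (cycle_graph n) = (\<lambda>j. {j, Suc j mod n}) ` (r ` {..<n})"
    by (simp add: E image_image)
  also have "\<dots> = edges (cycle_graph n)"
    by (simp add: img E)
  finally show "map_graph r (cycle_graph n) = cycle_graph n"
    using img by (simp add: map_graph_def prod_eq_iff)
qed

lemma k_bondage_sets_rotate:
  fixes n a :: nat
  assumes "3 \<le> n" "F \<in> k_bondage_sets k (cycle_graph n)"
  defines "r \<equiv> \<lambda>i. (i + a) mod n"
  shows "(`) r ` F \<in> k_bondage_sets k (cycle_graph n)" "card ((`) r ` F) = card F"
proof -
  have r: "inj_on r {..<n}" "map_graph r (cycle_graph n) = cycle_graph n"
    unfolding r_def using map_graph_rotate_cycle[of n a] assms(1) by auto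
  have F: "F \<subseteq> edges (cycle_graph n)"
    using assms(2) by (simp add: k_bondage_sets_def)
  have "edges (cycle_graph n) \<subseteq> Pow {..<n}"
    using assms(1) by (auto simp: cycle_graph_def)
  then have inj: "inj_on ((`) r) (edges (cycle_graph n))"
    using r(1) by (meson inj_on_image_Pow inj_on_subset)
  then show "card ((`) r ` F) = card F"
    using F by (meson card_image inj_on_subset)
  have E: "(`) r ` edges (cycle_graph n) = edges (cycle_graph n)" and V: "r ` {..<n} = {..<n}"
    using r(2) by (auto simp: map_graph_def prod_eq_iff)
  let ?G = "delete_edges (cycle_graph n) F"
  \<comment> \<open>Injectivity on edges lets the rotation pass through the set difference.\<close>
  have "map_graph r ?G = delete_edges (cycle_graph n) ((`) r ` F)"
    using inj_on_image_set_diff[OF inj _ F, of "edges (cycle_graph n)"] E V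
    by (simp add: map_graph_def prod_eq_iff)
  moreover have "simple_graph ?G"
    using assms(1) by (intro simple_graph_delete_edges simple_graph_cycle)
  ultimately have "no_isolated (delete_edges (cycle_graph n) ((`) r ` F)) \<longleftrightarrow> no_isolated ?G"
    "total_domination_number (delete_edges (cycle_graph n) ((`) r ` F)) = total_domination_number ?G"
    using no_isolated_map_graph[of r ?G] td_number_map_graph[of r ?G] r(1) by simp_all
  moreover have "(`) r ` F \<subseteq> edges (cycle_graph n)"
    using F E by blast
  ultimately show "(`) r ` F \<in> k_bondage_sets k (cycle_graph n)"
    using assms(2) by (simp add: k_bondage_sets_def)
qed

text \<open>Since k >= 1, something must be deleted; some deleted edge is rotated to
  \<open>{n - 1, 0}\<close> and then dropped.\<close>

lemma k_bondage_sets_cycle_to_path: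
  assumes "3 \<le> n" "1 \<le> k" "F \<in> k_bondage_sets k (cycle_graph n)"
  obtains F' where "F' \<in> k_bondage_sets k (path_graph n)" "card F = card F' + 1"
proof -
  have F: "F \<subseteq> edges (cycle_graph n)"
    using assms(3) by (simp add: k_bondage_sets_def)
  have "F \<noteq> {}"
    using assms by (auto simp: k_bondage_sets_def)
  then obtain j where j: "j < n" "{j, Suc j mod n} \<in> F"
    using F by (fastforce simp: cycle_graph_def)
  \<comment> \<open>This offset carries \<open>j\<close> to \<open>n - 1\<close>, hence its cyclic
    successor to 0.\<close>
  define r where "r = (\<lambda>i. (i + (n - 1 - j)) mod n)"
  have "r j = n - 1"
    using j by (simp add: r_def)
  moreover have "r (Suc j mod n) = 0"
  proof -
    have "r (Suc j mod n) = (Suc j + (n - 1 - j)) mod n"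
      unfolding r_def by (rule mod_add_left_eq)
    also have "Suc j + (n - 1 - j) = n"
      using j(1) by simp
    finally show ?thesis
      by simp
  qed
  ultimately have "r ` {j, Suc j mod n} = {n - 1, 0}"
    by simp
  then have e: "{n - 1, 0} \<in> (`) r ` F"
    using j(2) by (metis image_eqI)
  have rot: "(`) r ` F \<in> k_bondage_sets k (cycle_graph n)" "card ((`) r ` F) = card F"
    unfolding r_def using k_bondage_sets_rotate assms by blast+
  have "finite ((`) r ` F)"
    using F finite_edges_cycle by (meson finite_imageI finite_subset)
  then have "card F = card ((`) r ` F - {{n - 1, 0}}) + 1"
    using e rot(2) by (metis Suc_eq_plus1 card_Suc_Diff1)
  then show thesis
    using that rot(1) k_bondage_sets_cycle_iff[OF assms(1) e] by blast
qed

lemma k_total_bondage_number_eqI: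
  assumes "F \<in> k_bondage_sets k G" "card F = m"
    and "\<And>F. F \<in> k_bondage_sets k G \<Longrightarrow> m \<le> card F"
  shows "k_total_bondage_number k G = enat m"
  unfolding k_total_bondage_number_def
  using assms by (intro antisym INF_greatest INF_lower2[of F]) auto

text \<open>One direction drops a rotated edge, the other adds the closing edge to a smallest set
  for the path. If the path has no such set, its value is \<open>\<infinity>\<close> and the second
  direction is trivial.\<close>

lemma k_total_bondage_number_cycle:
  assumes "3 \<le> n" "1 \<le> k"
  shows "k_total_bondage_number k (cycle_graph n) = k_total_bondage_number k (path_graph n) + 1"
proof (rule antisym)
  show "k_total_bondage_number k (path_graph n) + 1 \<le> k_total_bondage_number k (cycle_graph n)"
    unfolding k_total_bondage_number_def[of k "cycle_graph n"]
  proof (rule INF_greatest)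
    fix F assume "F \<in> k_bondage_sets k (cycle_graph n)"
    then obtain F' where F': "F' \<in> k_bondage_sets k (path_graph n)" "card F = card F' + 1"
      using k_bondage_sets_cycle_to_path[OF assms] by blast
    have "k_total_bondage_number k (path_graph n) \<le> enat (card F')"
      unfolding k_total_bondage_number_def by (rule INF_lower[OF F'(1)])
    then have "k_total_bondage_number k (path_graph n) + 1 \<le> enat (card F') + 1"
      by (rule add_right_mono)
    also have "\<dots> = enat (card F)"
      by (simp add: F'(2) one_enat_def)
    finally show "k_total_bondage_number k (path_graph n) + 1 \<le> enat (card F)" .
  qed
next
  show "k_total_bondage_number k (cycle_graph n) \<le> k_total_bondage_number k (path_graph n) + 1"
  proof (cases "k_bondage_sets k (path_graph n) = {}")
    case True
    then show ?thesis
      by (simp add: k_total_bondage_number_def[of k "path_graph n"] top_enat_def)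
  next
    case False
    then obtain F where F: "F \<in> k_bondage_sets k (path_graph n)"
      "\<And>F'. F' \<in> k_bondage_sets k (path_graph n) \<Longrightarrow> card F \<le> card F'"
      using ex_has_least_nat[of "\<lambda>F. F \<in> k_bondage_sets k (path_graph n)" _ card] by blast
    have eq: "k_total_bondage_number k (path_graph n) = enat (card F)"
      by (rule k_total_bondage_number_eqI) (use F in auto)
    let ?F = "insert {n - 1, 0} F"
    have sub: "F \<subseteq> edges (path_graph n)"
      using F(1) by (simp add: k_bondage_sets_def)
    then have "{n - 1, 0} \<notin> F"
      using edges_cycle_graph(2)[OF assms(1)] by blast
    then have mem: "?F \<in> k_bondage_sets k (cycle_graph n)"
      using k_bondage_sets_cycle_iff[OF assms(1), of ?F k] F(1) by simp
    have "finite F"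
      using sub finite_edges_cycle[of n] edges_cycle_graph(1)[OF assms(1)]
      by (metis finite_insert finite_subset)
    have "k_total_bondage_number k (cycle_graph n) \<le> enat (card ?F)"
      unfolding k_total_bondage_number_def by (rule INF_lower[OF mem])
    also have "\<dots> \<le> enat (card F) + 1"
      using \<open>finite F\<close> by (simp add: one_enat_def card_insert_if)
    finally show ?thesis
      by (simp add: eq)
  qed
qed

section \<open>The bondage number of the path\<close>

lemma card_path_bondage_set_ge:
  assumes "2 \<le> n" "F \<in> k_bondage_sets k (path_graph n)"
  shows "2 * path_td_number n + 2 * k \<le> n + 2 * card F + 2"
    and "n mod 4 \<noteq> (2 * card F + 2) mod 4 \<Longrightarrow> 2 * path_td_number n + 2 * k < n + 2 * card F + 2"
proof -
  have F: "F \<subseteq> edges (path_graph n)" "no_isolated (delete_edges (path_graph n) F)"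
    "path_td_number n + k \<le> total_domination_number (delete_edges (path_graph n) F)"
    using assms by (auto simp: k_bondage_sets_def path_graph_td_number)
  show "2 * path_td_number n + 2 * k \<le> n + 2 * card F + 2"
    and "n mod 4 \<noteq> (2 * card F + 2) mod 4 \<Longrightarrow> 2 * path_td_number n + 2 * k < n + 2 * card F + 2"
    using path_delete_td_number_upper[OF _ F(1,2)] F(3) assms(1) by auto
qed

text \<open>Two deleted edges are never consecutive, and no end edge is deleted.\<close>

lemma path_deleted_edges_bound:
  assumes "2 \<le> n" "F \<subseteq> edges (path_graph n)" "no_isolated (delete_edges (path_graph n) F)"
  shows "2 * card F + 2 \<le> n"
proof -
  define D where "D = {i \<in> {i. {i, Suc i} \<in> F}. Suc i < n}"
  have nbr: "\<exists>u<n. {u, v} \<notin> F \<and> (v = Suc u \<or> u = Suc v)" if "v < n" for v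
    using assms(3) that by (auto simp: no_isolated_def path_edge_iff)
  have D: "0 < i" "Suc i < n - 1" "Suc i \<notin> D" if "i \<in> D" for i
  proof -
    have i: "{i, Suc i} \<in> F" "Suc i < n"
      using that by (auto simp: D_def)
    show "0 < i"
    proof (rule ccontr)
      assume "\<not> 0 < i"
      then have "{Suc 0, 0} \<in> F"
        using i(1) by (simp add: insert_commute)
      then show False
        using nbr[of 0] assms(1) by auto
    qed
    obtain u where u: "u < n" "{u, Suc i} \<notin> F" "Suc i = Suc u \<or> u = Suc (Suc i)"
      using nbr[OF i(2)] by blast
    then have "u = Suc (Suc i)"
      using i(1) by auto
    then show "Suc i < n - 1" "Suc i \<notin> D"
      using u by (auto simp: D_def insert_commute)
  qed
  have fin: "finite D"
    by (rule finite_subset[of _ "{..<n}"]) (auto simp: D_def)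
  \<comment> \<open>\<open>D\<close> and its shift by one are disjoint and both lie in
    \<open>{1..n - 2}\<close>, which bounds twice the size of \<open>D\<close>.\<close>
  have "card D + card (Suc ` D) = card (D \<union> Suc ` D)"
    using fin D(3) by (intro card_Un_disjoint[symmetric]) auto
  also have "\<dots> \<le> card {1..n - 2}"
  proof (rule card_mono)
    show "D \<union> Suc ` D \<subseteq> {1..n - 2}"
    proof (intro subsetI)
      fix x assume "x \<in> D \<union> Suc ` D"
      then obtain i where i: "i \<in> D" "x = i \<or> x = Suc i"
        by blast
      show "x \<in> {1..n - 2}"
        using D(1,2)[OF i(1)] i(2) by auto
    qed
  qed simp
  also have "card (Suc ` D) = card D"
    by (simp add: card_image)
  finally show ?thesis
    using assms(1) card_path_cuts[OF assms(2)] by (simp add: D_def)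
qed

lemma path_bondage_set_exists:
  assumes "2 * m + 2 \<le> n" "path_td_number n + k \<le> 2 * m + path_td_number (n - 2 * m)"
  obtains F where "F \<in> k_bondage_sets k (path_graph n)" "card F = m"
proof -
  obtain F where F: "F \<subseteq> edges (path_graph n)" "card F = m"
    "no_isolated (delete_edges (path_graph n) F)"
    "2 * m + path_td_number (n - 2 * m) \<le> total_domination_number (delete_edges (path_graph n) F)"
    using path_cut_pairs[OF assms(1)] .
  then have "F \<in> k_bondage_sets k (path_graph n)"
    using assms by (auto simp: k_bondage_sets_def path_graph_td_number)
  then show thesis
    using that F(2) by blast
qed

definition path_bondage_value :: "nat \<Rightarrow> nat \<Rightarrow> nat" where
  "path_bondage_value n k = (if n mod 4 = 0 then 2 * ((k - 1) div 2) + 1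
     else if n mod 4 = 1 \<or> n mod 4 = 3 then k
     else 2 * ((k - 1) div 2) + 2)"

text \<open>The first value is the largest odd number at most \<open>k\<close>, the last one the
  least even number at least \<open>k\<close>. This parity form is the one that the bounds
  produce.\<close>

lemma path_bondage_value_cases:
  assumes "2 \<le> k"
  obtains (mod0) "n mod 4 = 0" "path_bondage_value n k = (if even k then k - 1 else k)"
    | (odd) "odd n" "path_bondage_value n k = k"
    | (mod2) "n mod 4 = 2" "path_bondage_value n k = (if even k then k else k + 1)"
proof -
  have half: "2 * ((k - 1) div 2) = (if even k then k - 2 else k - 1)"
  proof (cases "even k")
    case True
    then obtain j where "k = 2 * j"
      by (auto elim: evenE)
    moreover from this obtain i where "j = Suc i"
      using assms(1) by (cases j) auto
    ultimately show ?thesis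
      by simp
  next
    case False
    then obtain j where "k = 2 * j + 1"
      by (auto elim: oddE)
    then show ?thesis
      by simp
  qed
  have odd: "odd n" if "n mod 4 = 1 \<or> n mod 4 = 3"
  proof
    assume "even n"
    then have "even (n mod 4)"
      by (simp add: dvd_mod_iff)
    then show False
      using that by auto
  qed
  consider "n mod 4 = 0" | "n mod 4 = 1 \<or> n mod 4 = 3" | "n mod 4 = 2"
    using mod_4_cases[of n] by auto
  then show ?thesis
  proof cases
    case 1
    then show ?thesis
      using half assms(1) by (intro mod0) (cases "even k"; simp add: path_bondage_value_def)+
  next
    case 2
    then show ?thesis
      using that(2) odd by (auto simp: path_bondage_value_def)
  next
    case 3
    then show ?thesis
      using half assms(1) by (intro mod2) (cases "even k"; simp add: path_bondage_value_def)+
  qed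
qed

lemma double_mod_4: "(2 * m) mod 4 = (if even m then 0 else 2)" for m :: nat
  using mult_mod_right[of 2 m 2] by (auto simp: even_iff_mod_2_eq_zero)

text \<open>For n = 0 modulo 4 the segment bound gives \<open>k \<le> card F + 1\<close>, with
  equality only for odd \<open>card F\<close>; for n = 2 it gives \<open>k \<le> card F\<close>,
  with equality only for even \<open>card F\<close>. For odd \<open>n\<close> integrality alone
  yields \<open>k \<le> card F\<close>.\<close>

lemma card_path_bondage_set_ge_value:
  assumes "2 \<le> n" "2 \<le> k" "F \<in> k_bondage_sets k (path_graph n)"
  defines "m \<equiv> path_bondage_value n k"
  shows "m \<le> card F"
proof -
  have parity: "(2 * card F + 2) mod 4 = (if even (card F) then 2 else 0)"
    using double_mod_4[of "card F + 1"] by simp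
  note le = card_path_bondage_set_ge(1)[OF assms(1,3)]
  note less = card_path_bondage_set_ge(2)[OF assms(1,3), unfolded parity]
  consider "n mod 4 = 0" "m = (if even k then k - 1 else k)" | "odd n" "m = k"
    | "n mod 4 = 2" "m = (if even k then k else k + 1)"
    unfolding m_def using path_bondage_value_cases[OF \<open>2 \<le> k\<close>] .
  then show ?thesis
  proof cases
    case 1
    have "k \<le> card F + 1" "even (card F) \<Longrightarrow> k < card F + 1"
      using le less path_td_number_cases(1)[OF 1(1)] 1(1) by auto
    then show ?thesis
      unfolding 1(2) using le_neq_implies_less[of "card F + 1" k] by (cases "k = card F + 1") auto
  next
    case 2
    then show ?thesis
      using le path_td_number_cases(2)[OF 2(1)] by linarith
  next
    case 3
    have "k \<le> card F" "odd (card F) \<Longrightarrow> k < card F"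
      using le less path_td_number_cases(3)[OF 3(1)] 3(1) by auto
    then show ?thesis
      unfolding 3(2) by (cases "k = card F") auto
  qed
qed

text \<open>For even \<open>n\<close> the parity of \<open>m\<close> leaves a remaining path of
  length 2 modulo 4, so every segment has the largest excess. For odd \<open>n\<close> the remaining
  length is odd as well and the excess does not change.\<close>

lemma path_bondage_set_exists_value:
  fixes n k :: nat
  defines "m \<equiv> path_bondage_value n k"
  assumes "2 * m + 2 \<le> n" "2 \<le> k"
  obtains F where "F \<in> k_bondage_sets k (path_graph n)" "card F = m"
proof -
  define n' where "n' = n - 2 * m"
  have n: "n = n' + 2 * m"
    using assms(2) by (simp add: n'_def)
  have mod: "(n' mod 4 + (2 * m) mod 4) mod 4 = n mod 4"
    by (simp add: n mod_add_eq)
  consider "n mod 4 = 0" "m = (if even k then k - 1 else k)" | "odd n" "m = k"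
    | "n mod 4 = 2" "m = (if even k then k else k + 1)"
    unfolding m_def using path_bondage_value_cases[OF \<open>2 \<le> k\<close>] .
  then have "path_td_number n + k \<le> 2 * m + path_td_number n'"
  proof cases
    case 1
    have "odd m"
      using 1(2) assms(3) by auto
    then have sum0: "(n' mod 4 + 2) mod 4 = 0"
      using mod 1(1) by (simp only: double_mod_4 if_False)
    have "x = 2" if "x = 0 \<or> x = 1 \<or> x = 2 \<or> x = 3" "(x + 2) mod 4 = 0" for x :: nat
      using that by (elim disjE) simp_all
    from this[OF mod_4_cases sum0] have "n' mod 4 = 2" .
    then have "2 * path_td_number n' = n' + 2"
      by (rule path_td_number_cases)
    then show ?thesis
      using path_td_number_cases(1)[OF 1(1)] 1(2) n by (auto split: if_splits)
  next
    case 2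
    then have "odd n'"
      by (simp add: n)
    from path_td_number_cases(2)[OF this] show ?thesis
      using path_td_number_cases(2)[OF 2(1)] 2(2) n by linarith
  next
    case 3
    have "even m"
      using 3(2) by auto
    then have "n' mod 4 = 2"
      using mod 3(1) by (simp add: double_mod_4)
    then have "2 * path_td_number n' = n' + 2"
      by (rule path_td_number_cases)
    then show ?thesis
      using path_td_number_cases(3)[OF 3(1)] 3(2) n by (auto split: if_splits)
  qed
  then show thesis
    using path_bondage_set_exists[OF assms(2)] that unfolding n'_def by blast
qed

text \<open>As \<open>m\<close> is within 1 of \<open>k\<close>, only small values of
  \<open>d = n - 2 * k\<close> can fail, and the residue of \<open>n\<close> rules out most of them.
  What remains is \<open>d = 1\<close> for odd \<open>n\<close>, and \<open>d = 0\<close> with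
  \<open>k\<close> odd, where n = 2 modulo 4.\<close>

lemma bondage_value_fits_iff:
  fixes n k m :: nat
  assumes "2 \<le> k" "2 * k \<le> n"
  defines "m \<equiv> path_bondage_value n k"
  shows "2 * m + 2 \<le> n \<longleftrightarrow> \<not> (n = 2 * k + 1 \<or> (n = 2 * k \<and> odd k))"
proof -
  define d where "d = n - 2 * k"
  have n: "n = 2 * k + d"
    using assms(2) by (simp add: d_def)
  consider "n mod 4 = 0" "m = (if even k then k - 1 else k)" | "odd n" "m = k"
    | "n mod 4 = 2" "m = (if even k then k else k + 1)"
    unfolding m_def using path_bondage_value_cases[OF \<open>2 \<le> k\<close>] .
  then show ?thesis
  proof cases
    case 1
    then have "even n"
      by (metis dvd_mod_iff even_numeral even_zero dvd_eq_mod_eq_0 dvd_trans)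
    then have "d \<noteq> 1"
      by (auto simp: n)
    moreover have "d \<noteq> 0" if "odd k"
    proof
      assume "d = 0"
      then have "n = 2 * k"
        by (simp add: n)
      then show False
        using 1(1) that double_mod_4[of k] by simp
    qed
    ultimately show ?thesis
      using 1(2) n assms(1) by auto
  next
    case 2
    then have "0 < d"
      by (intro odd_pos) (simp add: n)
    then show ?thesis
      using 2(2) n by auto
  next
    case 3
    have ev: "even n"
    proof (rule ccontr)
      assume "odd n"
      then have "odd (n mod 4)"
        by (simp add: dvd_mod_iff)
      then show False
        using 3(1) by simp
    qed
    then have "d \<noteq> 1" "d \<noteq> 3"
      by (auto simp: n)
    moreover have "d \<noteq> 0" if "even k"
      using 3(1) that double_mod_4[of k] by (auto simp: n)
    moreover have "d \<noteq> 2" if "odd k"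
    proof
      assume "d = 2"
      then have "n = 2 * (k + 1)"
        by (simp add: n)
      then show False
        using 3(1) that double_mod_4[of "k + 1"] by simp
    qed
    ultimately show ?thesis
      using 3(2) n by (auto split: if_splits)
  qed
qed

text \<open>In the exceptional cases at most \<open>k - 1\<close> edges can be deleted without
  isolating a vertex, while \<open>k\<close> or \<open>k + 1\<close> would be required. The value is
  then \<open>\<infinity>\<close> for path and cycle alike.\<close>

theorem theorem3p5:
  fixes k n :: nat
  assumes "k \<ge> 2" and "n \<ge> 2 * k"
  shows "(k_total_bondage_number k (path_graph n) \<noteq> \<infinity> \<longleftrightarrow>
            \<not> (n = 2 * k + 1 \<or> (n = 2 * k \<and> odd k))) \<and>
         (k_total_bondage_number k (path_graph n) \<noteq> \<infinity> \<longrightarrow>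
            k_total_bondage_number k (path_graph n) =
              enat (if n mod 4 = 0 then 2 * ((k - 1) div 2) + 1
                    else if n mod 4 = 1 \<or> n mod 4 = 3 then k
                    else 2 * ((k - 1) div 2) + 2)) \<and>
         k_total_bondage_number k (cycle_graph n) =
           k_total_bondage_number k (path_graph n) + 1"
proof -
  define m where "m = path_bondage_value n k"
  have n: "2 \<le> n" "3 \<le> n"
    using assms by auto
  note ge = card_path_bondage_set_ge_value[OF n(1) assms(1), folded m_def]
  \<comment> \<open>Every bondage set has at least \<open>m\<close> edges, and
    \<open>2 * card F + 2 \<le> n\<close> holds for every admissible \<open>F\<close>. So if
    \<open>m\<close> edges do not fit, there is no bondage set at all.\<close>
  have "k_total_bondage_number k (path_graph n) = (if 2 * m + 2 \<le> n then enat m else \<infinity>)"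
  proof (cases "2 * m + 2 \<le> n")
    case True
    then obtain F where "F \<in> k_bondage_sets k (path_graph n)" "card F = m"
      using path_bondage_set_exists_value[OF _ assms(1), of n] unfolding m_def by blast
    then show ?thesis
      using True ge by (simp add: k_total_bondage_number_eqI)
  next
    case False
    have "2 * m + 2 \<le> n" if "F \<in> k_bondage_sets k (path_graph n)" for F
      using ge[OF that] path_deleted_edges_bound[OF n(1), of F] that
      by (simp add: k_bondage_sets_def)
    then have "k_bondage_sets k (path_graph n) = {}"
      using False by blast
    then show ?thesis
      using False by (simp add: k_total_bondage_number_def top_enat_def)
  qed
  then show ?thesis
    using bondage_value_fits_iff[OF assms, folded m_def] k_total_bondage_number_cycle[OF n(2), of k] assms(1)
    unfolding path_bondage_value_def[symmetric] m_def[symmetric] by auto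
qed

end
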